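(* Let $K$ be a convex body in $\mathbb{E}^d$, $d \geq 3$, let $k$ be an integer with $2 \leq k \leq d-1$, and let $\{H_{\alpha}\}_{\alpha \in \mathcal{A}}$ be a family of $k$-dimensional affine subspaces of $\mathbb{E}^d$, each of which intersects the interior of $K$, such that: (i) for every supporting line $l$ of $K$ there exists $\alpha \in \mathcal{A}$ with $l \subset H_{\alpha}$; (ii) for every $\alpha \in \mathcal{A}$, the intersection $K \cap H_{\alpha}$ is a $k$-dimensional polytope. Then $K$ is a polytope.
   Context: A convex body is a compact convex subset of $\mathbb{E}^d$ with non-empty interior. A line $l$ is a supporting line of $K$ if $l \cap K \neq \emptyset$ and $l \cap K \subset \partial K$. A (convex) polytope is the convex hull of finitely many points. *)

theory Defs
  imports "HOL-Analysis.Analysis"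
begin

definition convex_body :: "'a::euclidean_space set \<Rightarrow> bool" where
  "convex_body K \<longleftrightarrow> compact K \<and> convex K \<and> interior K \<noteq> {}"

definition is_line :: "'a::euclidean_space set \<Rightarrow> bool" where
  "is_line l \<longleftrightarrow> affine l \<and> aff_dim l = 1"

definition supporting_line :: "'a::euclidean_space set \<Rightarrow> 'a set \<Rightarrow> bool" where
  "supporting_line K l \<longleftrightarrow> is_line l \<and> l \<inter> K \<noteq> {} \<and> l \<inter> K \<subseteq> frontier K"

end

theory Submission
  imports Defs
begin

text \<open>
  Let \<open>C\<^sub>x\<close> be the cone generated by \<open>K - x\<close>. If \<open>x\<close> is a boundary point and \<open>u\<close> lies in the closure
  of \<open>C\<^sub>x\<close> but not in \<open>C\<^sub>x\<close>, then \<open>u\<close> spans a supporting line at \<open>x\<close>. A polytopal section through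
  this line and an interior point \<open>p\<close> generates a closed cone that contains \<open>u + e(p - x)\<close> for all
  \<open>e > 0\<close>, hence \<open>u\<close>, a contradiction. So all the cones \<open>C\<^sub>x\<close> are closed.

  Downward induction on the dimension of the lineality space of \<open>C\<^sub>x\<close> shows that \<open>K\<close> coincides
  with \<open>x + C\<^sub>x\<close> near \<open>x\<close>: for a unit vector \<open>u\<close> of \<open>C\<^sub>x\<close> orthogonal to the lineality space and
  \<open>y = x + e u\<close> with \<open>x + 2 e u\<close> in \<open>K\<close>, the cone \<open>C\<^sub>y\<close> contains \<open>C\<^sub>x\<close> and the line through \<open>u\<close>, so
  local conicity at \<open>y\<close> puts \<open>x + e v\<close> into \<open>K\<close> for all \<open>v\<close> in \<open>C\<^sub>x\<close> close to \<open>u\<close>, and compactness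
  makes \<open>e\<close> uniform. Therefore every \<open>x\<close> in \<open>K\<close> has a neighbourhood containing no extreme point
  other than \<open>x\<close>, and by compactness there are finitely many extreme points.
\<close>

section \<open>Feasible direction cones and their lineality spaces\<close>

definition dir_cone :: "'a::real_vector set \<Rightarrow> 'a \<Rightarrow> 'a set" where
  "dir_cone K x = {v. \<exists>t>0. x + t *\<^sub>R v \<in> K}"

text \<open>For convex \<open>K\<close> and \<open>x\<close> in \<open>K\<close> this is the largest
  linear subspace contained in the cone, that is, the direction space of the smallest face of
  \<open>K\<close> through \<open>x\<close>.\<close>

definition lin_space :: "'a::real_vector set \<Rightarrow> 'a \<Rightarrow> 'a set" where
  "lin_space K x = {v. v \<in> dir_cone K x \<and> - v \<in> dir_cone K x}"

lemma dir_coneI: "t > 0 \<Longrightarrow> x + t *\<^sub>R v \<in> K \<Longrightarrow> v \<in> dir_cone K x"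
  by (auto simp: dir_cone_def)

lemma dir_cone_mono: "K \<subseteq> L \<Longrightarrow> dir_cone K x \<subseteq> dir_cone L x"
  by (auto simp: dir_cone_def)

lemma convex_ray_shrink:
  assumes "convex K" "x \<in> K" "x + t *\<^sub>R v \<in> K" "0 \<le> s" "s \<le> t"
  shows "x + s *\<^sub>R v \<in> K"
proof (cases "t = 0")
  case True
  with assms show ?thesis by simp
next
  case False
  with assms have "t > 0" by simp
  have "(1 - s/t) *\<^sub>R x + (s/t) *\<^sub>R (x + t *\<^sub>R v) \<in> K"
    using assms \<open>t > 0\<close> by (intro convexD) auto
  moreover have "(1 - s/t) *\<^sub>R x + (s/t) *\<^sub>R (x + t *\<^sub>R v) = x + s *\<^sub>R v"
    using \<open>t > 0\<close> by (simp add: algebra_simps)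
  ultimately show ?thesis by simp
qed

lemma convex_midpoint_dir:
  assumes "convex K" "x + 2 *\<^sub>R u \<in> K" "x + 2 *\<^sub>R v \<in> K"
  shows "x + (u + v) \<in> K"
proof -
  have "(1/2) *\<^sub>R (x + 2 *\<^sub>R u) + (1/2) *\<^sub>R (x + 2 *\<^sub>R v) \<in> K"
    using assms by (intro convexD) auto
  moreover have "(1/2) *\<^sub>R (x + 2 *\<^sub>R u) + (1/2) *\<^sub>R (x + 2 *\<^sub>R v) = x + (u + v)"
    by (simp add: algebra_simps flip: scaleR_add_left)
  ultimately show ?thesis by simp
qed

lemma dir_cone_0: "x \<in> K \<Longrightarrow> 0 \<in> dir_cone K x"
  by (auto simp: dir_cone_def intro: exI[of _ 1])

lemma dir_cone_scale:
  assumes "x \<in> K" "v \<in> dir_cone K x" "c \<ge> 0"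
  shows "c *\<^sub>R v \<in> dir_cone K x"
proof (cases "c = 0")
  case True
  with assms show ?thesis by (simp add: dir_cone_0)
next
  case False
  from assms obtain t where "t > 0" "x + t *\<^sub>R v \<in> K" by (auto simp: dir_cone_def)
  with False assms show ?thesis
    by (intro dir_coneI[of "t/c"]) auto
qed

lemma dir_cone_add:
  assumes "convex K" "x \<in> K" "u \<in> dir_cone K x" "v \<in> dir_cone K x"
  shows "u + v \<in> dir_cone K x"
proof -
  from assms obtain s t where st: "s > 0" "x + s *\<^sub>R u \<in> K" "t > 0" "x + t *\<^sub>R v \<in> K"
    by (auto simp: dir_cone_def)
  define r where "r = min s t / 2"
  have "x + (2 * r) *\<^sub>R u \<in> K" "x + (2 * r) *\<^sub>R v \<in> K"
    using st assms by (auto simp: r_def intro: convex_ray_shrink[of K x s] convex_ray_shrink[of K x t])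
  then have "x + (r *\<^sub>R u + r *\<^sub>R v) \<in> K"
    using assms by (intro convex_midpoint_dir) auto
  then show ?thesis
    using st by (intro dir_coneI[of r]) (auto simp: r_def scaleR_add_right)
qed

lemma subspace_lin_space:
  assumes "convex K" "x \<in> K"
  shows "subspace (lin_space K x)"
  unfolding subspace_def
proof (intro conjI ballI allI)
  show "0 \<in> lin_space K x"
    using assms by (simp add: lin_space_def dir_cone_0)
next
  fix u v assume "u \<in> lin_space K x" "v \<in> lin_space K x"
  then show "u + v \<in> lin_space K x"
    using assms dir_cone_add[of K x u v] dir_cone_add[of K x "-u" "-v"]
    by (simp add: lin_space_def)
next
  fix c :: real and u assume u: "u \<in> lin_space K x"
  then have "c *\<^sub>R u \<in> dir_cone K x \<and> (- c) *\<^sub>R u \<in> dir_cone K x"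
    using assms dir_cone_scale[of x K u c] dir_cone_scale[of x K "-u" c]
      dir_cone_scale[of x K u "-c"] dir_cone_scale[of x K "-u" "-c"]
    by (cases "c \<ge> 0") (auto simp: lin_space_def)
  then show "c *\<^sub>R u \<in> lin_space K x"
    by (simp add: lin_space_def)
qed

text \<open>The point \<open>x\<close> is relatively interior to the slice of \<open>K\<close> by
  the translate of the lineality space through \<open>x\<close>, because every segment of the slice
  ending at \<open>x\<close> can be prolonged beyond \<open>x\<close>. This is local conicity in the
  lineality directions, and it needs no closedness.\<close>

lemma lin_space_locally_in:
  fixes K :: "'a::euclidean_space set"
  assumes "convex K" "x \<in> K"
  obtains d where "d > 0" "\<And>v. v \<in> lin_space K x \<Longrightarrow> norm v < d \<Longrightarrow> x + v \<in> K"
proof -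
  define L where "L = lin_space K x"
  define S where "S = K \<inter> (+) x ` L"
  have L: "subspace L"
    using subspace_lin_space[OF assms] by (simp add: L_def)
  have inS: "x + v \<in> S \<longleftrightarrow> x + v \<in> K \<and> v \<in> L" for v
    by (auto simp: S_def)
  have xS: "x \<in> S"
    using inS[of 0] assms subspace_0[OF L] by simp
  have cS: "convex S"
    unfolding S_def using assms(1) convex_translation[OF subspace_imp_convex[OF L]] by (rule convex_Int)
  have "x \<in> rel_interior S"
  proof (subst convex_rel_interior_iff[OF cS])
    show "S \<noteq> {}" using xS by auto
    show "\<forall>y\<in>S. \<exists>e>1. (1 - e) *\<^sub>R y + e *\<^sub>R x \<in> S"
    proof
      fix y assume "y \<in> S"
      then obtain v where v: "v \<in> L" "y = x + v" by (auto simp: S_def)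
      then obtain t where t: "t > 0" "x + t *\<^sub>R (- v) \<in> K"
        by (auto simp: L_def lin_space_def dir_cone_def)
      have "(1 - (1 + t)) *\<^sub>R y + (1 + t) *\<^sub>R x = x + t *\<^sub>R (- v)"
        by (simp add: v algebra_simps)
      also have "\<dots> \<in> S"
        using t v L inS[of "t *\<^sub>R (- v)"] subspace_scale[OF L, of v "-t"] by simp
      finally show "\<exists>e>1. (1 - e) *\<^sub>R y + e *\<^sub>R x \<in> S"
        using t by (intro exI[of _ "1 + t"]) auto
    qed
  qed
  then obtain e where e: "e > 0" "ball x e \<inter> affine hull S \<subseteq> S"
    by (auto simp: mem_rel_interior_ball)
  show ?thesis
  proof
    show "e > 0" by fact
    fix v assume v: "v \<in> lin_space K x" "norm v < e"
    then obtain t where t: "t > 0" "x + t *\<^sub>R v \<in> K"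
      by (auto simp: lin_space_def dir_cone_def)
    have "x + t *\<^sub>R v \<in> S"
      using inS[of "t *\<^sub>R v"] t v subspace_scale[OF L, of v t] by (simp add: L_def)
    \<comment> \<open>The affine hull of the slice contains the whole line through \<open>x\<close>
      in direction \<open>v\<close>, so the relative ball around \<open>x\<close> captures
      \<open>x + v\<close> itself.\<close>
    then have "(1 - 1/t) *\<^sub>R x + (1/t) *\<^sub>R (x + t *\<^sub>R v) \<in> affine hull S"
      using xS by (intro mem_affine affine_affine_hull) (auto intro: hull_inc)
    also have "(1 - 1/t) *\<^sub>R x + (1/t) *\<^sub>R (x + t *\<^sub>R v) = x + v"
      using t by (simp add: algebra_simps)
    finally show "x + v \<in> K"
      using e v by (auto simp: S_def dist_norm)
  qed
qed

text \<open>Averaging \<open>x + (2 * e) u\<close> with a point \<open>x + t v\<close> of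
  \<open>K\<close> gives \<open>x + e u + (t/2) v\<close>, so a direction feasible at
  \<open>x\<close> stays feasible after moving along \<open>u\<close>. The new point is the midpoint
  of a segment of \<open>K\<close> parallel to \<open>u\<close>, hence both \<open>u\<close> and
  \<open>-u\<close> are feasible there.\<close>

lemma dir_cone_along_ray:
  assumes "convex K" "x \<in> K" "e > 0" "x + (2 * e) *\<^sub>R u \<in> K"
  shows "x + e *\<^sub>R u \<in> K" "dir_cone K x \<subseteq> dir_cone K (x + e *\<^sub>R u)"
    "u \<in> lin_space K (x + e *\<^sub>R u)"
proof -
  show "x + e *\<^sub>R u \<in> K"
    by (rule convex_ray_shrink[of K x "2 * e"]) (use assms in auto)
  show "dir_cone K x \<subseteq> dir_cone K (x + e *\<^sub>R u)"
  proof
    fix v assume "v \<in> dir_cone K x"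
    then obtain t where t: "t > 0" "x + t *\<^sub>R v \<in> K" by (auto simp: dir_cone_def)
    have "x + (e *\<^sub>R u + (t/2) *\<^sub>R v) \<in> K"
      using assms t by (intro convex_midpoint_dir) auto
    then show "v \<in> dir_cone K (x + e *\<^sub>R u)"
      using t by (intro dir_coneI[of "t/2"]) (auto simp: add.assoc)
  qed
  have "u \<in> dir_cone K (x + e *\<^sub>R u)"
    using assms by (intro dir_coneI[of e]) (auto simp: add.assoc simp flip: scaleR_add_left)
  moreover have "- u \<in> dir_cone K (x + e *\<^sub>R u)"
    using assms by (intro dir_coneI[of e]) auto
  ultimately show "u \<in> lin_space K (x + e *\<^sub>R u)"
    by (simp add: lin_space_def)
qed

section \<open>Local conicity and finiteness of the set of extreme points\<close>

lemma locally_conic: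
  fixes K :: "'a::euclidean_space set"
  assumes "convex K" and clo: "\<And>x. x \<in> K \<Longrightarrow> closed (dir_cone K x)" and "x \<in> K"
  shows "\<exists>e>0. \<forall>v\<in>dir_cone K x. norm v < e \<longrightarrow> x + v \<in> K"
  using \<open>x \<in> K\<close>
\<comment> \<open>The measure drops when the lineality space grows; since dimensions are bounded by
  \<open>DIM('a)\<close>, truncated subtraction does no harm.\<close>
proof (induction "DIM('a) - dim (lin_space K x)" arbitrary: x rule: less_induct)
  case less
  define L where "L = lin_space K x"
  have L: "subspace L"
    using subspace_lin_space[OF \<open>convex K\<close> \<open>x \<in> K\<close>] by (simp add: L_def)
  \<comment> \<open>Closedness of the cone enters here: it makes this set of unit directions
    compact.\<close>
  define S where "S = dir_cone K x \<inter> sphere 0 1 \<inter> L\<^sup>\<bottom>"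
  have "compact S"
    unfolding S_def
    by (intro compact_Int_closed closed_Int_compact[OF clo[OF \<open>x \<in> K\<close>] compact_sphere]
        closed_subspace subspace_orthogonal_comp)
  have "\<exists>e r. e > 0 \<and> r > 0 \<and> (\<forall>v\<in>dir_cone K x. dist u v < r \<longrightarrow> x + e *\<^sub>R v \<in> K)"
    if "u \<in> S" for u
  proof -
    from that obtain t where t: "t > 0" "x + t *\<^sub>R u \<in> K" and u: "norm u = 1" "u \<in> L\<^sup>\<bottom>"
      by (auto simp: S_def dir_cone_def)
    define e where "e = t/2"
    have e: "e > 0" "x + (2 * e) *\<^sub>R u \<in> K" using t by (auto simp: e_def)
    define y where "y = x + e *\<^sub>R u"
    note y = dir_cone_along_ray[OF \<open>convex K\<close> \<open>x \<in> K\<close> e, folded y_def]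
    have "u \<notin> L"
    proof
      assume "u \<in> L"
      with u have "orthogonal u u" by (auto simp: orthogonal_comp_def)
      with u show False by (simp add: orthogonal_self)
    qed
    with y have "L \<subset> lin_space K y" by (auto simp: L_def lin_space_def)
    then have "dim L < dim (lin_space K y)"
      using subspace_lin_space[OF \<open>convex K\<close> y(1)] L by (intro dim_psubset) (simp add: span_eq_iff[THEN iffD2])
    moreover have "dim (lin_space K y) \<le> DIM('a)" by (rule dim_subset_UNIV)
    ultimately obtain d where d: "d > 0" "\<forall>v\<in>dir_cone K y. norm v < d \<longrightarrow> y + v \<in> K"
      using less.hyps[OF _ y(1)] unfolding L_def by fastforce
    \<comment> \<open>The radius \<open>d/e\<close> comes from writing
      \<open>x + e v = y + e (v - u)\<close>. The vector \<open>v - u\<close> is feasible at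
      \<open>y\<close>, as both \<open>v\<close> and \<open>-u\<close> are.\<close>
    have "x + e *\<^sub>R v \<in> K" if v: "v \<in> dir_cone K x" "dist u v < d/e" for v
    proof -
      have "v + - u \<in> dir_cone K y"
        using y v by (intro dir_cone_add[OF \<open>convex K\<close>]) (auto simp: lin_space_def)
      then have "e *\<^sub>R (v - u) \<in> dir_cone K y"
        using dir_cone_scale[OF y(1), of "v - u" e] e by simp
      moreover have "norm (e *\<^sub>R (v - u)) < d"
        using v(2) e(1) by (simp add: dist_norm norm_minus_commute pos_less_divide_eq mult.commute)
      ultimately have "y + e *\<^sub>R (v - u) \<in> K" using d by blast
      then show ?thesis by (simp add: y_def algebra_simps)
    qed
    then show ?thesis using e d by (intro exI[of _ e] exI[of _ "d/e"]) auto
  qed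
  then obtain e r where er: "\<And>u. u \<in> S \<Longrightarrow> e u > 0 \<and> r u > 0 \<and>
      (\<forall>v\<in>dir_cone K x. dist u v < r u \<longrightarrow> x + e u *\<^sub>R v \<in> K)"
    by metis
  obtain D where D: "D \<subseteq> S" "finite D" "S \<subseteq> (\<Union>u\<in>D. ball u (r u))"
    using \<open>compact S\<close> by (rule compactE_image[of S S "\<lambda>u. ball u (r u)"]) (use er in auto)
  \<comment> \<open>The extra element 1 keeps the minimum meaningful when \<open>S\<close>, and
    hence \<open>D\<close>, is empty.\<close>
  define \<epsilon> where "\<epsilon> = Min (insert 1 (e ` D))"
  have "\<epsilon> > 0" using D er by (auto simp: \<epsilon>_def)
  have unif: "x + \<epsilon> *\<^sub>R v \<in> K" if "v \<in> S" for v
  proof -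
    from that D obtain u where u: "u \<in> D" "dist u v < r u" by auto
    moreover have "u \<in> S" "v \<in> dir_cone K x" using u D that by (auto simp: S_def)
    ultimately have "x + e u *\<^sub>R v \<in> K" using er by blast
    moreover have "\<epsilon> \<le> e u" using D u by (auto simp: \<epsilon>_def)
    ultimately show ?thesis
      using convex_ray_shrink[OF \<open>convex K\<close> \<open>x \<in> K\<close>] \<open>\<epsilon> > 0\<close> less_imp_le by blast
  qed
  obtain d where d: "d > 0" "\<And>v. v \<in> lin_space K x \<Longrightarrow> norm v < d \<Longrightarrow> x + v \<in> K"
    using lin_space_locally_in[OF \<open>convex K\<close> \<open>x \<in> K\<close>] by blast
  \<comment> \<open>With \<open>v = l + z\<close> split orthogonally along \<open>L\<close>, the
    point \<open>x + v\<close> is the midpoint of \<open>x + 2 l\<close> and \<open>x + 2 z\<close>.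
    This doubling is the reason for halving the bound.\<close>
  have "x + v \<in> K" if v: "v \<in> dir_cone K x" "norm v < min \<epsilon> d / 2" for v
  proof -
    obtain l z where lz: "l \<in> span L" "\<And>w. w \<in> span L \<Longrightarrow> orthogonal z w" "v = l + z"
      using orthogonal_subspace_decomp_exists[of L v] by metis
    have l: "l \<in> L" using lz L by (simp add: span_eq_iff[THEN iffD2])
    have z: "z \<in> L\<^sup>\<bottom>" 
      using lz by (auto simp: orthogonal_comp_def orthogonal_commute span_base)
    have "(norm v)\<^sup>2 = (norm l)\<^sup>2 + (norm z)\<^sup>2"
      using lz by (metis norm_add_Pythagorean orthogonal_commute)
    then have "(norm l)\<^sup>2 \<le> (norm v)\<^sup>2" "(norm z)\<^sup>2 \<le> (norm v)\<^sup>2" by simp_all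
    then have nrm: "norm l \<le> norm v" "norm z \<le> norm v"
      by (simp_all only: norm_ge_zero power2_le_iff_abs_le abs_norm_cancel)
    have "2 *\<^sub>R l \<in> L" using l L by (simp add: subspace_scale)
    then have "x + 2 *\<^sub>R l \<in> K" using d nrm v by (auto simp: L_def)
    moreover have "x + 2 *\<^sub>R z \<in> K"
    proof (cases "z = 0")
      case True
      then show ?thesis using \<open>x \<in> K\<close> by simp
    next
      case False
      have "z = v + - l" using lz by simp
      also have "\<dots> \<in> dir_cone K x"
        using v l by (intro dir_cone_add[OF \<open>convex K\<close> \<open>x \<in> K\<close>]) (auto simp: L_def lin_space_def)
      finally have "(1 / norm z) *\<^sub>R z \<in> dir_cone K x"
        by (intro dir_cone_scale[OF \<open>x \<in> K\<close>]) auto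
      moreover have "(1 / norm z) *\<^sub>R z \<in> L\<^sup>\<bottom>"
        using z by (intro subspace_scale subspace_orthogonal_comp)
      ultimately have "(1 / norm z) *\<^sub>R z \<in> S"
        using False by (simp add: S_def)
      then have "x + \<epsilon> *\<^sub>R ((1 / norm z) *\<^sub>R z) \<in> K" by (rule unif)
      then have "x + (\<epsilon> / norm z) *\<^sub>R z \<in> K" by simp
      moreover have "2 \<le> \<epsilon> / norm z"
        using False nrm v by (simp add: field_simps)
      ultimately show ?thesis
        using convex_ray_shrink[OF \<open>convex K\<close> \<open>x \<in> K\<close>] zero_le_numeral by blast
    qed
    ultimately show ?thesis
      using convex_midpoint_dir[OF \<open>convex K\<close>] lz by blast
  qed
  then show ?case
    using \<open>\<epsilon> > 0\<close> d by (intro exI[of _ "min \<epsilon> d / 2"]) auto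
qed

lemma polytope_if_closed_dir_cones:
  fixes K :: "'a::euclidean_space set"
  assumes "compact K" "convex K" and clo: "\<And>x. x \<in> K \<Longrightarrow> closed (dir_cone K x)"
  shows "polytope K"
proof -
  have "\<exists>e>0. \<forall>z. z extreme_point_of K \<longrightarrow> dist x z < e \<longrightarrow> z = x" if "x \<in> K" for x
  proof -
    have "\<exists>e>0. \<forall>v\<in>dir_cone K x. norm v < e \<longrightarrow> x + v \<in> K"
      by (rule locally_conic) (use assms that in auto)
    then obtain e where e: "e > 0" "\<forall>v\<in>dir_cone K x. norm v < e \<longrightarrow> x + v \<in> K"
      by blast
    \<comment> \<open>An extreme point \<open>z\<close> other than \<open>x\<close> cannot be the
      midpoint of \<open>x\<close> and its reflection \<open>x + 2 v\<close>. The radius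
      \<open>e/2\<close> ensures that this reflection stays in \<open>K\<close>.\<close>
    have "z = x" if z: "z extreme_point_of K" "dist x z < e/2" for z
    proof (rule ccontr)
      assume "z \<noteq> x"
      define v where "v = z - x"
      have "z \<in> K" using z by (simp add: extreme_point_of_def)
      then have "v \<in> dir_cone K x" by (intro dir_coneI[of 1]) (auto simp: v_def)
      then have "2 *\<^sub>R v \<in> dir_cone K x" using \<open>x \<in> K\<close> by (intro dir_cone_scale) auto
      moreover have "norm (2 *\<^sub>R v) < e" using z by (simp add: v_def dist_norm norm_minus_commute)
      ultimately have "x + 2 *\<^sub>R v \<in> K" using e by blast
      moreover have "z \<in> open_segment x (x + 2 *\<^sub>R v)"
        using \<open>z \<noteq> x\<close> unfolding in_segment
        by (auto simp: v_def algebra_simps intro!: exI[of _ "1/2"])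
      ultimately show False using z \<open>x \<in> K\<close> by (auto simp: extreme_point_of_def)
    qed
    then show ?thesis using e by (intro exI[of _ "e/2"]) auto
  qed
  then obtain e where e: "\<And>x. x \<in> K \<Longrightarrow> e x > 0 \<and> (\<forall>z. z extreme_point_of K \<longrightarrow> dist x z < e x \<longrightarrow> z = x)"
    by metis
  obtain D where D: "D \<subseteq> K" "finite D" "K \<subseteq> (\<Union>x\<in>D. ball x (e x))"
    using \<open>compact K\<close> by (rule compactE_image[of K K "\<lambda>x. ball x (e x)"]) (use e in auto)
  have "{z. z extreme_point_of K} \<subseteq> D"
  proof safe
    fix z assume z: "z extreme_point_of K"
    then have "z \<in> K" by (simp add: extreme_point_of_def)
    then obtain x where "x \<in> D" "dist x z < e x" using D by auto
    then show "z \<in> D" using e z D by blast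
  qed
  then have "finite {z. z extreme_point_of K}"
    using D finite_subset by blast
  then show ?thesis
    unfolding polytope_def using Krein_Milman_Minkowski[OF assms(1,2)] by blast
qed

section \<open>Direction cones of polytopes\<close>

lemma dir_cone_halfspace:
  assumes "a \<bullet> x \<le> b"
  shows "dir_cone {y. a \<bullet> y \<le> b} x = (if a \<bullet> x = b then {v. a \<bullet> v \<le> 0} else UNIV)"
proof -
  have "v \<in> dir_cone {y. a \<bullet> y \<le> b} x" if "a \<bullet> x < b" for v
  proof -
    \<comment> \<open>The step length keeps the increase \<open>t * (a \<bullet> v)\<close> within
      the slack \<open>b - a \<bullet> x\<close>; adding 1 avoids division by zero.\<close>
    define t where "t = (b - a \<bullet> x) / (\<bar>a \<bullet> v\<bar> + 1)"
    have "t > 0" using that by (simp add: t_def)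
    have "t * (a \<bullet> v) \<le> t * (\<bar>a \<bullet> v\<bar> + 1)" using \<open>t > 0\<close> by (intro mult_left_mono) auto
    also have "\<dots> = b - a \<bullet> x" by (simp add: t_def)
    finally show ?thesis
      using \<open>t > 0\<close> by (intro dir_coneI[of t]) (auto simp: inner_add_right)
  qed
  moreover have "v \<in> dir_cone {y. a \<bullet> y \<le> b} x \<longleftrightarrow> a \<bullet> v \<le> 0" if "a \<bullet> x = b" for v
    using that by (auto simp: dir_cone_def inner_add_right mult_le_0_iff intro: exI[of _ 1])
  ultimately show ?thesis using assms by auto
qed

text \<open>A direction feasible for each of two convex sets is feasible for their intersection,
  using the smaller step length. Finiteness of \<open>F\<close> lets this be iterated.\<close>

lemma dir_cone_Inter:
  assumes "finite F" "\<And>h. h \<in> F \<Longrightarrow> convex h \<and> x \<in> h"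
  shows "dir_cone (\<Inter>F) x = (\<Inter>h\<in>F. dir_cone h x)"
  using assms
proof (induction F rule: finite_induct)
  case empty
  then show ?case by (auto simp: dir_cone_def intro: exI[of _ 1])
next
  case (insert h F)
  have "dir_cone (h \<inter> \<Inter>F) x = dir_cone h x \<inter> dir_cone (\<Inter>F) x"
  proof (intro equalityI subsetI)
    fix v assume "v \<in> dir_cone h x \<inter> dir_cone (\<Inter>F) x"
    then obtain s t where st: "s > 0" "x + s *\<^sub>R v \<in> h" "t > 0" "x + t *\<^sub>R v \<in> \<Inter>F"
      by (auto simp: dir_cone_def)
    have "x + min s t *\<^sub>R v \<in> h"
      by (rule convex_ray_shrink[of h x s]) (use insert.prems st in auto)
    moreover have "x + min s t *\<^sub>R v \<in> \<Inter>F"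
      by (rule convex_ray_shrink[of "\<Inter>F" x t]) (use insert.prems st in \<open>auto intro!: convex_Inter\<close>)
    ultimately show "v \<in> dir_cone (h \<inter> \<Inter>F) x"
      using st by (intro dir_coneI[of "min s t"]) auto
  qed (auto simp: dir_cone_def)
  with insert show ?case by simp
qed

text \<open>A polytope is a finite intersection of half-spaces. Those active at \<open>x\<close>
  contribute closed half-spaces to the cone, the others the whole space.\<close>

lemma closed_dir_cone_polytope:
  fixes P :: "'a::euclidean_space set"
  assumes "polytope P" "x \<in> P"
  shows "closed (dir_cone P x)"
proof -
  from assms obtain F where F: "finite F" "P = \<Inter>F"
    "\<And>h. h \<in> F \<Longrightarrow> \<exists>a b. a \<noteq> 0 \<and> h = {y. a \<bullet> y \<le> b}"
    using polytope_imp_polyhedron unfolding polyhedron_def by metis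
  have "dir_cone P x = (\<Inter>h\<in>F. dir_cone h x)"
    unfolding F(2)
  proof (rule dir_cone_Inter[OF F(1)])
    fix h assume "h \<in> F"
    then show "convex h \<and> x \<in> h"
      using F assms(2) by (metis InterE convex_halfspace_le)
  qed
  also have "closed \<dots>"
  proof (intro closed_INT ballI)
    fix h assume h: "h \<in> F"
    then obtain a b where ab: "h = {y. a \<bullet> y \<le> b}" using F by blast
    then have "a \<bullet> x \<le> b" using h assms F by auto
    then show "closed (dir_cone h x)"
      by (simp add: ab dir_cone_halfspace closed_halfspace_le)
  qed
  finally show ?thesis .
qed

section \<open>Interior directions and supporting lines\<close>

lemma interior_in_dir_cone:
  fixes K :: "'a::euclidean_space set"
  assumes "y \<in> interior K"
  shows "y - x \<in> interior (dir_cone K x)"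
proof -
  have "(\<lambda>y. y - x) ` interior K \<subseteq> dir_cone K x"
    using interior_subset[of K] by (auto simp: dir_cone_def intro!: exI[of _ 1])
  moreover have "open ((\<lambda>y. y - x) ` interior K)"
    by (intro open_translation_subtract open_interior)
  ultimately show ?thesis
    using assms by (meson image_eqI interior_maximal subsetD)
qed

lemma convex_dir_cone:
  assumes "convex K" "x \<in> K"
  shows "convex (dir_cone K x)"
  using assms by (auto simp: convex_def intro!: dir_cone_add dir_cone_scale)

lemma dir_cone_interior:
  fixes K :: "'a::euclidean_space set"
  assumes "x \<in> interior K"
  shows "dir_cone K x = UNIV"
proof -
  obtain e where e: "e > 0" "cball x e \<subseteq> K"
    using assms by (auto simp: mem_interior_cball)
  have "v \<in> dir_cone K x" for v
  proof (rule dir_coneI)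
    show "e / (norm v + 1) > 0" using e by (simp add: add_nonneg_pos)
    have "norm v * e \<le> (norm v + 1) * e" using e by (intro mult_right_mono) auto
    then have "x + (e / (norm v + 1)) *\<^sub>R v \<in> cball x e"
      using e by (simp add: dist_norm add_nonneg_pos divide_simps mult.commute)
    then show "x + (e / (norm v + 1)) *\<^sub>R v \<in> K" using e by blast
  qed
  then show ?thesis by auto
qed

lemma interior_add_closure_dir_cone:
  fixes K :: "'a::euclidean_space set"
  assumes "convex K" "x \<in> K" "w \<in> interior (dir_cone K x)" "u \<in> closure (dir_cone K x)" "e > 0"
  shows "u + e *\<^sub>R w \<in> interior (dir_cone K x)"
proof -
  \<comment> \<open>With this \<open>s\<close>, the vector \<open>u + e w\<close> is
    \<open>1 + e\<close> times the convex combination \<open>(1 - s) u + s w\<close>, which is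
    interior because \<open>w\<close> is interior and \<open>u\<close> is in the closure. Positive
    scaling preserves the interior of the cone.\<close>
  define s where "s = e / (1 + e)"
  have s: "0 < s" "s \<le> 1" using assms by (auto simp: s_def field_simps)
  have "u - s *\<^sub>R (u - w) \<in> interior (dir_cone K x)"
    using mem_interior_closure_convex_shrink[OF convex_dir_cone[OF assms(1,2)] assms(3,4) s(1,2)] .
  then have "(1 + e) *\<^sub>R (u - s *\<^sub>R (u - w)) \<in> (*\<^sub>R) (1 + e) ` interior (dir_cone K x)"
    by blast
  also have "\<dots> \<subseteq> interior (dir_cone K x)"
    using assms dir_cone_scale[of x K _ "1 + e"] interior_subset[of "dir_cone K x"]
    by (intro interior_maximal open_scaling open_interior) auto
  also have "(1 + e) *\<^sub>R (u - s *\<^sub>R (u - w)) = u + e *\<^sub>R w"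
  proof -
    have "(1 + e) * s = e" using assms by (simp add: s_def)
    then show ?thesis
      by (simp add: scaleR_right_diff_distrib scaleR_left_distrib)
  qed
  finally show ?thesis .
qed

lemma supporting_line_closure_dir_cone:
  fixes K :: "'a::euclidean_space set"
  assumes "convex K" "x \<in> frontier K" "x \<in> K" "u \<in> closure (dir_cone K x)" "u \<notin> dir_cone K x"
  shows "supporting_line K (range (\<lambda>t. x + t *\<^sub>R u))" (is "supporting_line K ?l")
proof -
  have "u \<noteq> 0" using assms dir_cone_0 by blast
  have l: "?l = (+) x ` span {u}" by (auto simp: span_singleton)
  have "is_line ?l"
    unfolding is_line_def l using \<open>u \<noteq> 0\<close>
    by (simp add: affine_translation[symmetric] subspace_imp_affine aff_dim_translation_eq aff_dim_subspace)
  moreover have "x \<in> ?l \<inter> K" using assms by (auto intro!: range_eqI[of _ _ 0])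
  moreover have "?l \<inter> interior K = {}"
  proof (rule ccontr)
    assume "?l \<inter> interior K \<noteq> {}"
    then obtain t where t: "x + t *\<^sub>R u \<in> interior K" by auto
    have tu: "t *\<^sub>R u \<in> interior (dir_cone K x)"
      using interior_in_dir_cone[OF t, of x] by simp
    have "t \<noteq> 0" using t assms by (auto simp: frontier_def)
    show False
    proof (cases "t > 0")
      case True
      then have "u \<in> dir_cone K x"
        using t interior_subset by (intro dir_coneI[of t]) auto
      with assms show False by simp
    next
      case False
      with \<open>t \<noteq> 0\<close> have t0: "t < 0" by simp
      \<comment> \<open>The factor \<open>1 / - t\<close> makes the sum vanish, so 0 is interior to
        the cone. Some positive multiple of \<open>u\<close>, and therefore \<open>u\<close>, then
        lies in the cone.\<close>
      have "u + (1 / - t) *\<^sub>R (t *\<^sub>R u) \<in> interior (dir_cone K x)"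
        using assms tu t0 by (intro interior_add_closure_dir_cone) auto
      then have "0 \<in> interior (dir_cone K x)" using t0 by simp
      then have "dir_cone (dir_cone K x) 0 = UNIV" by (rule dir_cone_interior)
      then obtain s where "s > 0" "s *\<^sub>R u \<in> dir_cone K x"
        by (auto simp: dir_cone_def[of "dir_cone K x"])
      then have "(1 / s) *\<^sub>R (s *\<^sub>R u) \<in> dir_cone K x"
        using \<open>x \<in> K\<close> by (intro dir_cone_scale[of x K "s *\<^sub>R u"]) auto
      with \<open>s > 0\<close> assms(5) show False by simp
    qed
  qed
  ultimately show ?thesis
    unfolding supporting_line_def frontier_def using closure_subset[of K] by blast
qed


theorem theorem1:
  fixes K :: "'a::euclidean_space set"
    and k :: nat
    and A :: "'i set"
    and H :: "'i \<Rightarrow> 'a set"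
  assumes "DIM('a) \<ge> 3"
    and "convex_body K"
    and "2 \<le> k" and "k \<le> DIM('a) - 1"
    and "\<And>\<alpha>. \<alpha> \<in> A \<Longrightarrow> affine (H \<alpha>) \<and> aff_dim (H \<alpha>) = int k"
    and "\<And>\<alpha>. \<alpha> \<in> A \<Longrightarrow> H \<alpha> \<inter> interior K \<noteq> {}"
    and "\<And>l. supporting_line K l \<Longrightarrow> \<exists>\<alpha>\<in>A. l \<subseteq> H \<alpha>"
    and "\<And>\<alpha>. \<alpha> \<in> A \<Longrightarrow> polytope (K \<inter> H \<alpha>) \<and> aff_dim (K \<inter> H \<alpha>) = int k"
  shows "polytope K"
proof -
  have K: "compact K" "convex K" using assms(2) by (auto simp: convex_body_def)
  show ?thesis
  proof (rule polytope_if_closed_dir_cones[OF K])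
    fix x assume "x \<in> K"
    show "closed (dir_cone K x)"
    proof (cases "x \<in> interior K")
      case True
      then show ?thesis by (simp add: dir_cone_interior)
    next
      case False
      with \<open>x \<in> K\<close> have fr: "x \<in> frontier K"
        using closure_subset by (auto simp: frontier_def)
      have "u \<in> dir_cone K x" if u: "u \<in> closure (dir_cone K x)" for u
      proof (rule ccontr)
        assume "u \<notin> dir_cone K x"
        then obtain \<alpha> where \<alpha>: "\<alpha> \<in> A" "range (\<lambda>t. x + t *\<^sub>R u) \<subseteq> H \<alpha>"
          using assms(7)[OF supporting_line_closure_dir_cone[OF K(2) fr \<open>x \<in> K\<close> u]] by blast
        define P where "P = K \<inter> H \<alpha>"
        have xH: "x + t *\<^sub>R u \<in> H \<alpha>" for t using \<alpha> by auto
        from xH[of 0] have xH0: "x \<in> H \<alpha>" by simp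
        obtain p where p: "p \<in> interior K" "p \<in> H \<alpha>" using assms(6)[OF \<alpha>(1)] by blast
        have "u + e *\<^sub>R (p - x) \<in> dir_cone P x" if "e > 0" for e
        proof -
          have "u + e *\<^sub>R (p - x) \<in> dir_cone K x"
            using interior_add_closure_dir_cone[OF K(2) \<open>x \<in> K\<close> interior_in_dir_cone[OF p(1)] u that]
              interior_subset by blast
          then obtain t where t: "t > 0" "x + t *\<^sub>R (u + e *\<^sub>R (p - x)) \<in> K"
            by (auto simp: dir_cone_def)
          \<comment> \<open>The weights 1, \<open>t * e\<close> and \<open>-(t * e)\<close> sum to
            1, so the point is an affine combination of points of the section plane.\<close>
          have "1 *\<^sub>R (x + t *\<^sub>R u) + (t * e) *\<^sub>R p + (- (t * e)) *\<^sub>R x \<in> H \<alpha>"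
            using assms(5)[OF \<alpha>(1)] xH p xH0 by (intro mem_affine_3) auto
          also have "1 *\<^sub>R (x + t *\<^sub>R u) + (t * e) *\<^sub>R p + (- (t * e)) *\<^sub>R x
              = x + t *\<^sub>R (u + e *\<^sub>R (p - x))"
            by (simp add: algebra_simps)
          finally show ?thesis
            using t by (auto simp: P_def intro: dir_coneI[of t])
        qed
        \<comment> \<open>Letting \<open>e\<close> tend to 0 from the right recovers
          \<open>u\<close>; the limit stays in the cone of the section, which is closed because the
          section is a polytope.\<close>
        then have "\<forall>\<^sub>F e in at_right 0. u + e *\<^sub>R (p - x) \<in> dir_cone P x"
          by (auto simp: eventually_at_filter)
        moreover have "((\<lambda>e. u + e *\<^sub>R (p - x)) \<longlongrightarrow> u + 0 *\<^sub>R (p - x)) (at_right (0::real))"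
          by (intro tendsto_intros)
        moreover have "closed (dir_cone P x)"
          using assms(8)[OF \<alpha>(1)] \<open>x \<in> K\<close> xH0
          by (intro closed_dir_cone_polytope) (auto simp: P_def)
        ultimately have "u + 0 *\<^sub>R (p - x) \<in> dir_cone P x"
          by (intro Lim_in_closed_set) auto
        then have "u \<in> dir_cone K x"
          using dir_cone_mono[of P K x] by (auto simp: P_def)
        with \<open>u \<notin> dir_cone K x\<close> show False by simp
      qed
      then show ?thesis
        using closure_subset_eq by blast
    qed
  qed
qed

end
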